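(* Let $A\in\mathbb{R}^{N\times N}$, $b\in\mathbb{R}^N$, and let $W_m\in\mathbb{R}^{N\times m}$, $W_{m+1}\in\mathbb{R}^{N\times(m+1)}$ and $\overline H_m\in\mathbb{R}^{(m+1)\times m}$ be the matrices produced by $m$ steps of the Arnoldi algorithm applied to $A$ and $b$, so that $AW_m=W_{m+1}\overline H_m$. For $1\le k\le m$, let $u_k^{(m)}\in\mathbb{R}^{m+1}$ and $v_k^{(m)}\in\mathbb{R}^m$ be respectively the left and right singular vectors relative to the singular value $\sigma_k^{(m)}$ of $\overline H_m$, that is, $\overline H_mv_k^{(m)}=\sigma_k^{(m)}u_k^{(m)}$ and $\overline H_m^Tu_k^{(m)}=\sigma_k^{(m)}v_k^{(m)}$. Then, defining $\overline u_k=W_{m+1}u_k^{(m)}$ and $\overline v_k=W_mv_k^{(m)}$, we have $$A\overline v_k-\sigma_k^{(m)}\overline u_k=0,$$ $$W_m^T\left(A^T\overline u_k-\sigma_k^{(m)}\overline v_k\right)=0.$$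
   Context: The Arnoldi algorithm applied to $A$ and $b$ builds (in exact arithmetic) an orthonormal basis $w_1,\dots,w_m$ of the Krylov subspace $\mathcal{K}_m(A,b)=\mathrm{span}\{b,Ab,\dots,A^{m-1}b\}$, starting from $w_1=b/\|b\|$. With $W_m=[w_1,\dots,w_m]$ it satisfies $AW_m=W_mH_m+h_{m+1,m}w_{m+1}e_m^T$, where $H_m=(h_{i,j})\in\mathbb{R}^{m\times m}$ is upper Hessenberg and $e_m=(0,\dots,0,1)^T\in\mathbb{R}^m$; equivalently $AW_m=W_{m+1}\overline H_m$, where $W_{m+1}=[w_1,\dots,w_{m+1}]$ has orthonormal columns and $\overline H_m=\begin{bmatrix}H_m\\ h_{m+1,m}e_m^T\end{bmatrix}\in\mathbb{R}^{(m+1)\times m}$. It is assumed that the process has not terminated before producing $w_{m+1}$ (i.e. $h_{j+1,j}\ne0$ for $1\le j\le m$). *)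

theory Defs
  imports Complex_Main "Jordan_Normal_Form.Matrix"
begin

definition vec_nrm :: "real vec \<Rightarrow> real"
  where "vec_nrm x = sqrt (x \<bullet> x)"

definition vec_normalized :: "real vec \<Rightarrow> real vec"
  where "vec_normalized x = (1 / vec_nrm x) \<cdot>\<^sub>v x"

text \<open>
  The Arnoldi algorithm (Gram-Schmidt form):
  \<open>w\<^sub>1 = b / \<parallel>b\<parallel>\<close>, and for \<open>j = 1, 2, \<dots>\<close>
  \<open>h\<^sub>i\<^sub>,\<^sub>j = w\<^sub>i\<^sup>T A w\<^sub>j\<close> for \<open>1 \<le> i \<le> j\<close>,
  \<open>r\<^sub>j = A w\<^sub>j - (h\<^sub>1\<^sub>,\<^sub>j w\<^sub>1 + \<dots> + h\<^sub>j\<^sub>,\<^sub>j w\<^sub>j)\<close>,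
  \<open>h\<^sub>j\<^sub>+\<^sub>1\<^sub>,\<^sub>j = \<parallel>r\<^sub>j\<parallel>\<close>, \<open>w\<^sub>j\<^sub>+\<^sub>1 = r\<^sub>j / h\<^sub>j\<^sub>+\<^sub>1\<^sub>,\<^sub>j\<close>.
  The recursion is on the unnormalised vectors \<open>r\<^sub>j\<close> with \<open>r\<^sub>0 = b\<close>, so that
  \<open>w\<^sub>j\<^sub>+\<^sub>1 = r\<^sub>j / \<parallel>r\<^sub>j\<parallel>\<close> for all \<open>j \<ge> 0\<close>. The indices of \<open>w\<close> and \<open>h\<close> start at 1.
  If \<open>r\<^sub>j = 0\<close> (breakdown), the later values are meaningless.
\<close>

fun arnoldi_residual :: "real mat \<Rightarrow> real vec \<Rightarrow> nat \<Rightarrow> real vec" where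
  "arnoldi_residual A b 0 = b"
| "arnoldi_residual A b (Suc j) =
     (let q = A *\<^sub>v vec_normalized (arnoldi_residual A b j)
      in vec (dim_row A) (\<lambda>l. q $ l -
           (\<Sum>i\<le>j. (vec_normalized (arnoldi_residual A b i) \<bullet> q) *
                    vec_normalized (arnoldi_residual A b i) $ l)))"

definition arnoldi_w :: "real mat \<Rightarrow> real vec \<Rightarrow> nat \<Rightarrow> real vec"
  where "arnoldi_w A b j = vec_normalized (arnoldi_residual A b (j - 1))"

definition arnoldi_h :: "real mat \<Rightarrow> real vec \<Rightarrow> nat \<Rightarrow> nat \<Rightarrow> real"
  where "arnoldi_h A b i j =
    (if i \<le> j then arnoldi_w A b i \<bullet> (A *\<^sub>v arnoldi_w A b j)
     else if i = j + 1 then vec_nrm (arnoldi_residual A b j)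
     else 0)"

text \<open>Rows and columns of \<^typ>\<open>real mat\<close> are numbered from 0, hence the shift by one.\<close>

definition arnoldi_W :: "real mat \<Rightarrow> real vec \<Rightarrow> nat \<Rightarrow> real mat"
  where "arnoldi_W A b m = mat_of_cols (dim_row A) (map (arnoldi_w A b) [1..<m + 1])"

definition arnoldi_Hbar :: "real mat \<Rightarrow> real vec \<Rightarrow> nat \<Rightarrow> real mat"
  where "arnoldi_Hbar A b m = mat (m + 1) m (\<lambda>(i, j). arnoldi_h A b (i + 1) (j + 1))"

definition arnoldi_no_breakdown :: "real mat \<Rightarrow> real vec \<Rightarrow> nat \<Rightarrow> bool"
  where "arnoldi_no_breakdown A b m \<longleftrightarrow>
    b \<noteq> 0\<^sub>v (dim_vec b) \<and> (\<forall>j\<in>{1..m}. arnoldi_h A b (j + 1) j \<noteq> 0)"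

definition singular_triplet :: "real mat \<Rightarrow> real \<Rightarrow> real vec \<Rightarrow> real vec \<Rightarrow> bool"
  where "singular_triplet M \<sigma> u v \<longleftrightarrow>
    u \<in> carrier_vec (dim_row M) \<and> v \<in> carrier_vec (dim_col M) \<and>
    vec_nrm u = 1 \<and> vec_nrm v = 1 \<and> \<sigma> \<ge> 0 \<and>
    M *\<^sub>v v = \<sigma> \<cdot>\<^sub>v u \<and> transpose_mat M *\<^sub>v u = \<sigma> \<cdot>\<^sub>v v"

end

theory Submission
  imports Defs
begin

text \<open>
  The Arnoldi recurrence gives \<open>A W\<^sub>m = W\<^sub>m\<^sub>+\<^sub>1 H\<close>, and as long as no residual vanishes
  the columns of \<open>W\<^sub>m\<^sub>+\<^sub>1\<close> are orthonormal. The first identity is the recurrence applied to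
  \<open>v\<close>; the second follows from
  \<open>W\<^sub>m\<^sup>T A\<^sup>T W\<^sub>m\<^sub>+\<^sub>1 u = (A W\<^sub>m)\<^sup>T W\<^sub>m\<^sub>+\<^sub>1 u = H\<^sup>T W\<^sub>m\<^sub>+\<^sub>1\<^sup>T W\<^sub>m\<^sub>+\<^sub>1 u = H\<^sup>T u = \<sigma> v\<close>.
\<close>

lemma vec_nrm_eq_0_iff: "vec_nrm x = 0 \<longleftrightarrow> x = 0\<^sub>v (dim_vec x)"
proof
  assume "vec_nrm x = 0"
  then have "(\<Sum>i<dim_vec x. x $ i * x $ i) = 0"
    by (simp add: vec_nrm_def scalar_prod_def atLeast0LessThan)
  then show "x = 0\<^sub>v (dim_vec x)"
    by (subst (asm) sum_nonneg_eq_0_iff) (auto intro!: eq_vecI)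
next
  assume "x = 0\<^sub>v (dim_vec x)"
  then have "x \<bullet> x = 0"
    by (metis carrier_vec_dim_vec scalar_prod_left_zero)
  then show "vec_nrm x = 0"
    by (simp add: vec_nrm_def)
qed

lemma vec_nrm_mult_self: "vec_nrm x * vec_nrm x = x \<bullet> x"
  unfolding vec_nrm_def by (simp add: scalar_prod_def sum_nonneg)

lemma dim_vec_normalized [simp]: "dim_vec (vec_normalized x) = dim_vec x"
  by (simp add: vec_normalized_def)

lemma vec_nrm_smult_normalized:
  "vec_nrm x \<noteq> 0 \<Longrightarrow> vec_nrm x \<cdot>\<^sub>v vec_normalized x = x"
  by (simp add: vec_normalized_def smult_smult_assoc)

lemma vec_normalized_self_prod:
  assumes "vec_nrm x \<noteq> 0"
  shows "vec_normalized x \<bullet> vec_normalized x = 1"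
proof -
  have "vec_normalized x \<bullet> vec_normalized x = (x \<bullet> x) / (vec_nrm x * vec_nrm x)"
    by (simp add: vec_normalized_def scalar_prod_def sum_divide_distrib)
  with assms show ?thesis by (simp flip: vec_nrm_mult_self)
qed

lemma arnoldi_residual_carrier:
  assumes "A \<in> carrier_mat N N" "b \<in> carrier_vec N"
  shows "arnoldi_residual A b j \<in> carrier_vec N"
  using assms by (cases j) (auto simp: Let_def)

lemma arnoldi_w_carrier:
  assumes "A \<in> carrier_mat N N" "b \<in> carrier_vec N"
  shows "arnoldi_w A b j \<in> carrier_vec N"
  using arnoldi_residual_carrier[OF assms, of "j - 1"]
  by (simp add: arnoldi_w_def vec_normalized_def)

text \<open>One unfolding of the recursion. For \<open>i \<le> j\<close> the entry
  \<open>arnoldi_h A b (Suc i) (Suc j)\<close> falls in the first branch of its definition, so it is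
  exactly the Gram-Schmidt coefficient that is subtracted. The successor equation is then removed
  from the simpset, so that later arguments treat residuals as opaque and enter the recursion only
  here.\<close>

lemma arnoldi_residual_index:
  assumes "A \<in> carrier_mat N N" "l < N"
  shows "arnoldi_residual A b (Suc j) $ l = (A *\<^sub>v arnoldi_w A b (Suc j)) $ l -
    (\<Sum>i\<le>j. arnoldi_h A b (Suc i) (Suc j) * arnoldi_w A b (Suc i) $ l)"
  using assms by (simp add: arnoldi_h_def arnoldi_w_def Let_def)

declare arnoldi_residual.simps(2) [simp del]

text \<open>The starting residual is \<open>b\<close>, and for \<open>j > 0\<close> the norm of the
  residual is by definition the subdiagonal entry \<open>arnoldi_h A b (j + 1) j\<close>. Allowing
  \<open>j = m\<close> covers the last vector, whose index is \<open>m + 1\<close>.\<close>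

lemma arnoldi_residual_nrm_nonzero:
  assumes "arnoldi_no_breakdown A b m" "j \<le> m"
  shows "vec_nrm (arnoldi_residual A b j) \<noteq> 0"
proof (cases j)
  case 0
  with assms show ?thesis
    by (simp add: arnoldi_no_breakdown_def vec_nrm_eq_0_iff)
next
  case (Suc i)
  with assms have "arnoldi_h A b (j + 1) j \<noteq> 0"
    by (auto simp: arnoldi_no_breakdown_def)
  then show ?thesis by (simp add: arnoldi_h_def)
qed

lemma arnoldi_w_self:
  assumes "arnoldi_no_breakdown A b m" "j \<le> m"
  shows "arnoldi_w A b (Suc j) \<bullet> arnoldi_w A b (Suc j) = 1"
  using vec_normalized_self_prod[OF arnoldi_residual_nrm_nonzero[OF assms]]
  by (simp add: arnoldi_w_def)

text \<open>Gram-Schmidt by strong induction on \<open>j\<close>: the vectors before the new one are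
  already orthonormal, so subtracting the projections onto them leaves a residual orthogonal to
  each.\<close>

lemma arnoldi_w_orthogonal_less:
  assumes A: "A \<in> carrier_mat N N" and b: "b \<in> carrier_vec N"
    and nb: "arnoldi_no_breakdown A b m"
  shows "i < j \<Longrightarrow> j \<le> m \<Longrightarrow> arnoldi_w A b (Suc i) \<bullet> arnoldi_w A b (Suc j) = 0"
proof (induction j arbitrary: i rule: less_induct)
  case (less j)
  obtain k where k: "j = Suc k" using less.prems by (cases j) auto
  let ?w = "\<lambda>i. arnoldi_w A b (Suc i)"
  let ?q = "A *\<^sub>v ?w k"
  have carr: "?w l \<in> carrier_vec N" for l
    using arnoldi_w_carrier[OF A b] .
  have r: "arnoldi_residual A b j \<in> carrier_vec N"
    using arnoldi_residual_carrier[OF A b] .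
  \<comment> \<open>Both \<open>i\<close> and \<open>l\<close> are at most \<open>k\<close>, hence
    below \<open>j\<close>, so the induction hypothesis applies at the larger of the two; symmetry
    of the scalar product handles \<open>l < i\<close>.\<close>
  have orth: "?w i \<bullet> ?w l = (if l = i then 1 else 0)" if "l \<le> k" for l
  proof (cases l i rule: linorder_cases)
    case less': less
    then have "?w l \<bullet> ?w i = 0"
      using less.IH[of i l] less.prems by simp
    then show ?thesis using less' comm_scalar_prod[OF carr carr, of l i] by simp
  next
    case equal
    then show ?thesis using arnoldi_w_self[OF nb, of i] less.prems by simp
  next
    case greater
    then show ?thesis using less.IH[of l i] less.prems that k by simp
  qed
  have "?w i \<bullet> arnoldi_residual A b j =
      (\<Sum>l<N. ?w i $ l * (?q $ l - (\<Sum>p\<le>k. arnoldi_h A b (Suc p) (Suc k) * ?w p $ l)))"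
    using r arnoldi_residual_index[OF A] by (simp add: k scalar_prod_def atLeast0LessThan)
  also have "\<dots> = (\<Sum>l<N. ?w i $ l * ?q $ l) -
      (\<Sum>l<N. \<Sum>p\<le>k. arnoldi_h A b (Suc p) (Suc k) * (?w i $ l * ?w p $ l))"
    by (simp add: right_diff_distrib sum_subtractf sum_distrib_left mult.left_commute)
  also have "(\<Sum>l<N. \<Sum>p\<le>k. arnoldi_h A b (Suc p) (Suc k) * (?w i $ l * ?w p $ l)) =
      (\<Sum>p\<le>k. arnoldi_h A b (Suc p) (Suc k) * (?w i \<bullet> ?w p))"
    by (subst sum.swap) (simp add: carrier_vecD[OF carr] scalar_prod_def atLeast0LessThan sum_distrib_left)
  \<comment> \<open>By \<open>orth\<close> only the summand \<open>p = i\<close> survives. Its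
    coefficient is the projection of \<open>?q\<close> onto \<open>?w i\<close>, which is also the
    value of the first sum, so the difference vanishes.\<close>
  also have "\<dots> = arnoldi_h A b (Suc i) (Suc k)"
    using less.prems k by (simp add: orth if_distrib cong: if_cong)
  also have "\<dots> = ?w i \<bullet> ?q"
    using less.prems k by (simp add: arnoldi_h_def)
  also have "(\<Sum>l<N. ?w i $ l * ?q $ l) = ?w i \<bullet> ?q"
    using A by (simp add: scalar_prod_def atLeast0LessThan del: index_mult_mat_vec)
  \<comment> \<open>The new basis vector is a scalar multiple of the residual, so orthogonality
    carries over.\<close>
  finally show ?case
    using r carr by (simp add: arnoldi_w_def[of A b "Suc j"] vec_normalized_def)
qed

lemma arnoldi_w_orthonormal:
  assumes A: "A \<in> carrier_mat N N" and b: "b \<in> carrier_vec N"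
    and nb: "arnoldi_no_breakdown A b m" and "i \<le> m" "j \<le> m"
  shows "arnoldi_w A b (Suc i) \<bullet> arnoldi_w A b (Suc j) = (if i = j then 1 else 0)"
proof (cases i j rule: linorder_cases)
  case greater
  then show ?thesis
    using assms arnoldi_w_orthogonal_less[OF A b nb, of j i]
      comm_scalar_prod[OF arnoldi_w_carrier[OF A b] arnoldi_w_carrier[OF A b]]
    by simp
qed (use assms arnoldi_w_orthogonal_less[OF A b nb, of i j] arnoldi_w_self[OF nb, of i] in auto)

lemma arnoldi_W_carrier:
  "A \<in> carrier_mat N N \<Longrightarrow> arnoldi_W A b m \<in> carrier_mat N m"
  by (auto simp: arnoldi_W_def)

lemma arnoldi_W_index:
  "A \<in> carrier_mat N N \<Longrightarrow> i < N \<Longrightarrow> j < m \<Longrightarrow>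
    arnoldi_W A b m $$ (i, j) = arnoldi_w A b (Suc j) $ i"
  by (simp add: arnoldi_W_def mat_of_cols_index nth_append del: upt_Suc)

lemma arnoldi_W_col:
  assumes "A \<in> carrier_mat N N" "b \<in> carrier_vec N" "j < m"
  shows "col (arnoldi_W A b m) j = arnoldi_w A b (Suc j)"
  using arnoldi_W_carrier[OF assms(1), of b m] arnoldi_w_carrier[OF assms(1,2), of "Suc j"] assms
  by (intro eq_vecI) (auto simp: arnoldi_W_index)

text \<open>The bound on \<open>n\<close> admits both \<open>n = m\<close> and
  \<open>n = m + 1\<close>, since the second identity of the theorem needs orthonormality of either
  matrix.\<close>

lemma arnoldi_W_gram:
  assumes A: "A \<in> carrier_mat N N" and b: "b \<in> carrier_vec N"
    and nb: "arnoldi_no_breakdown A b m" and n: "n \<le> m + 1"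
  shows "transpose_mat (arnoldi_W A b n) * arnoldi_W A b n = 1\<^sub>m n"
  using n arnoldi_W_carrier[OF A, of b n]
  by (intro eq_matI) (auto simp: arnoldi_W_col[OF A b] arnoldi_w_orthonormal[OF A b nb])

text \<open>Column by column this is the definition of the residual solved for
  \<open>A *\<^sub>v ?w j\<close>, with the residual rewritten as the subdiagonal entry times the
  next basis vector.\<close>

lemma arnoldi_relation:
  assumes A: "A \<in> carrier_mat N N" and b: "b \<in> carrier_vec N"
    and nb: "arnoldi_no_breakdown A b m"
  shows "A * arnoldi_W A b m = arnoldi_W A b (m + 1) * arnoldi_Hbar A b m"
proof (rule eq_matI)
  let ?w = "\<lambda>i. arnoldi_w A b (Suc i)"
  let ?h = "\<lambda>i j. arnoldi_h A b (Suc i) (Suc j)"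
  note W = arnoldi_W_carrier[OF A, of b]
  fix l j
  assume "l < dim_row (arnoldi_W A b (m + 1) * arnoldi_Hbar A b m)"
    and "j < dim_col (arnoldi_W A b (m + 1) * arnoldi_Hbar A b m)"
  then have l: "l < N" and j: "j < m"
    using W[of "m + 1"] by (auto simp: arnoldi_Hbar_def)
  let ?r = "arnoldi_residual A b (Suc j)"
  have r: "?r = ?h (Suc j) j \<cdot>\<^sub>v ?w (Suc j)"
    using vec_nrm_smult_normalized[OF arnoldi_residual_nrm_nonzero[OF nb, of "Suc j"]] j
    by (simp add: arnoldi_h_def arnoldi_w_def)
  have "(arnoldi_W A b (m + 1) * arnoldi_Hbar A b m) $$ (l, j) = (\<Sum>i\<le>m. ?w i $ l * ?h i j)"
    using l j W[of "m + 1"] A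
    by (simp add: scalar_prod_def arnoldi_Hbar_def arnoldi_W_index
        atLeast0LessThan lessThan_Suc_atMost del: sum.lessThan_Suc sum.op_ivl_Suc)
  \<comment> \<open>The Hessenberg shape: entries with \<open>i > Suc j\<close> are zero, and
    \<open>j < m\<close> keeps \<open>Suc j\<close> within the range of summation.\<close>
  also have "\<dots> = (\<Sum>i\<le>Suc j. ?w i $ l * ?h i j)"
    using j by (intro sum.mono_neutral_right) (auto simp: arnoldi_h_def)
  \<comment> \<open>The top summand \<open>i = Suc j\<close> is the residual, by
    \<open>r\<close>.\<close>
  also have "\<dots> = (\<Sum>i\<le>j. ?h i j * ?w i $ l) + ?r $ l"
    using l arnoldi_w_carrier[OF A b, of "Suc (Suc j)"] by (subst r) (simp add: mult.commute)
  also have "\<dots> = (A *\<^sub>v ?w j) $ l"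
    using arnoldi_residual_index[OF A l, of b j] by simp
  also have "\<dots> = (A * arnoldi_W A b m) $$ (l, j)"
    using A W[of m] l j by (simp add: arnoldi_W_col[OF A b])
  finally show "(A * arnoldi_W A b m) $$ (l, j) =
      (arnoldi_W A b (m + 1) * arnoldi_Hbar A b m) $$ (l, j)" by simp
qed (use A arnoldi_W_carrier[OF A, of b m] arnoldi_W_carrier[OF A, of b "m + 1"]
    in \<open>auto simp: arnoldi_Hbar_def\<close>)

theorem proposition7:
  fixes A :: "real mat" and b :: "real vec" and N m :: nat
    and \<sigma> :: "nat \<Rightarrow> real" and u v ubar vbar :: "nat \<Rightarrow> real vec"
  assumes A: "A \<in> carrier_mat N N"
    and b: "b \<in> carrier_vec N"
    and no_breakdown: "arnoldi_no_breakdown A b m"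
    and triplets: "\<forall>k\<in>{1..m}. singular_triplet (arnoldi_Hbar A b m) (\<sigma> k) (u k) (v k)"
    and ubar: "\<forall>k\<in>{1..m}. ubar k = arnoldi_W A b (m + 1) *\<^sub>v u k"
    and vbar: "\<forall>k\<in>{1..m}. vbar k = arnoldi_W A b m *\<^sub>v v k"
  shows "\<forall>k\<in>{1..m}.
    A *\<^sub>v vbar k - \<sigma> k \<cdot>\<^sub>v ubar k = 0\<^sub>v N \<and>
    transpose_mat (arnoldi_W A b m) *\<^sub>v
      (transpose_mat A *\<^sub>v ubar k - \<sigma> k \<cdot>\<^sub>v vbar k) = 0\<^sub>v m"
proof
  fix k assume k: "k \<in> {1..m}"
  let ?W = "arnoldi_W A b m" and ?V = "arnoldi_W A b (m + 1)" and ?H = "arnoldi_Hbar A b m"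
  have W: "?W \<in> carrier_mat N m" and V: "?V \<in> carrier_mat N (m + 1)"
    using arnoldi_W_carrier[OF A] by blast+
  have H: "?H \<in> carrier_mat (m + 1) m"
    by (simp add: arnoldi_Hbar_def)
  have uk: "u k \<in> carrier_vec (m + 1)" and vk: "v k \<in> carrier_vec m"
    and Hv: "?H *\<^sub>v v k = \<sigma> k \<cdot>\<^sub>v u k"
    and Hu: "transpose_mat ?H *\<^sub>v u k = \<sigma> k \<cdot>\<^sub>v v k"
    using triplets k H by (auto simp: singular_triplet_def)
  have ub: "ubar k = ?V *\<^sub>v u k" and vb: "vbar k = ?W *\<^sub>v v k"
    using ubar vbar k by auto
  have ubc: "ubar k \<in> carrier_vec N" and vbc: "vbar k \<in> carrier_vec N"
    unfolding ub vb using V W uk vk by (blast intro: mult_mat_vec_carrier)+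
  note rel = arnoldi_relation[OF A b no_breakdown]
  have "A *\<^sub>v vbar k = (A * ?W) *\<^sub>v v k"
    unfolding vb using A W vk by (rule assoc_mult_mat_vec[symmetric])
  also have "\<dots> = ?V *\<^sub>v (?H *\<^sub>v v k)"
    unfolding rel using V H vk by (rule assoc_mult_mat_vec)
  also have "\<dots> = \<sigma> k \<cdot>\<^sub>v ubar k"
    unfolding Hv ub using V uk by (rule mult_mat_vec)
  finally have first: "A *\<^sub>v vbar k - \<sigma> k \<cdot>\<^sub>v ubar k = 0\<^sub>v N"
    using ubc by simp
  have WT: "transpose_mat ?W \<in> carrier_mat m N"
    and VT: "transpose_mat ?V \<in> carrier_mat (m + 1) N"
    and HT: "transpose_mat ?H \<in> carrier_mat m (m + 1)"
    and AT: "transpose_mat A \<in> carrier_mat N N"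
    using W V H A by auto
  have "transpose_mat ?W *\<^sub>v (transpose_mat A *\<^sub>v ubar k) = transpose_mat (A * ?W) *\<^sub>v ubar k"
    unfolding transpose_mult[OF A W] using WT AT ubc by (rule assoc_mult_mat_vec[symmetric])
  also have "\<dots> = transpose_mat ?H *\<^sub>v (transpose_mat ?V *\<^sub>v ubar k)"
    unfolding rel transpose_mult[OF V H] using HT VT ubc by (rule assoc_mult_mat_vec)
  also have "transpose_mat ?V *\<^sub>v ubar k = (transpose_mat ?V * ?V) *\<^sub>v u k"
    unfolding ub using VT V uk by (rule assoc_mult_mat_vec[symmetric])
  \<comment> \<open>Orthonormality of all \<open>m + 1\<close> columns enters here, including the
    vector produced by the last step.\<close>
  also have "\<dots> = u k"
    using uk by (simp only: arnoldi_W_gram[OF A b no_breakdown order_refl] one_mult_mat_vec)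
  also note Hu
  finally have lhs: "transpose_mat ?W *\<^sub>v (transpose_mat A *\<^sub>v ubar k) = \<sigma> k \<cdot>\<^sub>v v k" .
  \<comment> \<open>The subtracted term projects to the same vector, now because the first
    \<open>m\<close> columns are orthonormal.\<close>
  have "transpose_mat ?W *\<^sub>v vbar k = (transpose_mat ?W * ?W) *\<^sub>v v k"
    unfolding vb using WT W vk by (rule assoc_mult_mat_vec[symmetric])
  also have "\<dots> = v k"
    using vk by (simp add: arnoldi_W_gram[OF A b no_breakdown])
  finally have rhs: "transpose_mat ?W *\<^sub>v (\<sigma> k \<cdot>\<^sub>v vbar k) = \<sigma> k \<cdot>\<^sub>v v k"
    by (simp add: mult_mat_vec[OF WT vbc])
  have "transpose_mat ?W *\<^sub>v (transpose_mat A *\<^sub>v ubar k - \<sigma> k \<cdot>\<^sub>v vbar k) =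
      \<sigma> k \<cdot>\<^sub>v v k - \<sigma> k \<cdot>\<^sub>v v k"
    using AT ubc vbc by (subst mult_minus_distrib_mat_vec[OF WT]) (auto simp: lhs rhs)
  also have "\<dots> = 0\<^sub>v m" using vk by simp
  finally show "A *\<^sub>v vbar k - \<sigma> k \<cdot>\<^sub>v ubar k = 0\<^sub>v N \<and>
    transpose_mat ?W *\<^sub>v (transpose_mat A *\<^sub>v ubar k - \<sigma> k \<cdot>\<^sub>v vbar k) = 0\<^sub>v m"
    using first by simp
qed

end
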